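(* Let $M\ge1$ and $1\le K\le M$ be integers, $0<p<1$, $P>1$, and let $N$ be the block length. Let $\beta^*=1+\frac{2}{(K+1)(1-2^{-K})}$, $q_0=(1-p)^M$ and $$N_w=\left\lceil\frac{K\log_2 M}{\log_2(N\log_2 N-1)-\log_2K}\right\rceil+1 .$$ Then the expected number of bits per channel use $\overline{R}_{\mathrm{net}}$ of the proposed scheme satisfies $$\overline{R}_{\mathrm{net}}\ \ge\ \left(\frac12\log_2^+(P)-\frac{N_w}{N}\log_2(N\log_2N)\right)\left(1-\frac{\beta^*-1}{\beta^*(1-q_0)}\,I_p(K+1,M-K)\right).$$
   Context: $\log_2^+(x)=\log_2 x$ if $x\ge1$ and $0$ otherwise. Generalized tree-splitting protocol with parameter $K\ge1$. Let $T(L)$ be the random number of slots used to resolve a group of $L\ge 0$ users. If $L=0$, exactly one (empty) slot is used. If $1\le L\le K$, exactly $L$ slots are used. If $L>K$, one slot is used (a collision), after which each of the $L$ users independently joins group 1 or group 2 with probability $1/2$ each; then group 1 is resolved by a fresh run of the same protocol (with independent randomness), and afterwards group 2 is resolved by a fresh run of the same protocol (this also applies to empty groups). $T(L)$ is the total number of slots, and $S(L)=\mathbb{E}[T(L)]$. User activity: there are $M$ users, each independently active with probability $p$; $q(L)=\binom{M}{L}p^L(1-p)^{M-L}$, $q_0=q(0)=(1-p)^M$, $\hat q(L)=q(L)/(1-q_0)$ for $L\ge 1$. Net rate: a slot consists of $N$ channel uses. The slot carries a signature of $N_w$ symbols over an alphabet of size $q=N\log_2 N$ (treated as a real parameter)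 together with a message of $D$ bits, at total rate $\frac12\log_2^+(P)$ bits per channel use (finite block length effects are ignored), so that $$D=\frac N2\log_2^+(P)-N_w\log_2(N\log_2N).$$ It is assumed throughout that $N$ is large enough that $N\log_2N-1> K$, that $M\le N\log_2N-1$, and that $D\ge0$ ($D$ is a number of bits). With $R_{\mathrm{net}}(L)=\frac{LD}{S(L)N}$, the average net rate is $$\overline{R}_{\mathrm{net}}=\sum_{L=1}^M R_{\mathrm{net}}(L)\,\hat q(L).$$ $I_x(a,b)=B_x(a,b)/B_1(a,b)$, with $B_x(a,b)=\int_0^x t^{a-1}(1-t)^{b-1}\,dt$, is the regularized incomplete beta function, with the convention $I_p(M+1,0)=0$. *)

theory Defs
  imports "HOL-Probability.Probability"
begin

text \<open>
  The user \<open>u < L\<close> joins group 1 iff \<open>g u\<close>. A possible non-terminating execution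
  corresponds to lost mass of the sub-probability mass function; the lemmas
  \<open>lossless_slots\<close> and \<open>integrable_slots\<close> below show that for \<open>K \<ge> 1\<close> no mass is lost and
  that the mean is finite.
\<close>

partial_function (spmf) slots :: "nat \<Rightarrow> nat \<Rightarrow> nat spmf" where
  "slots K L =
     (if L = 0 then return_spmf 1
      else if L \<le> K then return_spmf L
      else bind_spmf (spmf_of_pmf (Pi_pmf {..<L} False (\<lambda>_. bernoulli_pmf (1/2)))) (\<lambda>g.
           bind_spmf (slots K (card {u\<in>{..<L}. g u})) (\<lambda>t1.
           bind_spmf (slots K (card {u\<in>{..<L}. \<not> g u})) (\<lambda>t2.
             return_spmf (1 + t1 + t2)))))"

lemma card_compl: "card {u\<in>{..<L}. \<not> g u} = L - card {u\<in>{..<L::nat}. g u}"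
proof -
  have "{u\<in>{..<L}. \<not> g u} = {..<L} - {u\<in>{..<L}. g u}" by auto
  also have "card \<dots> = L - card {u\<in>{..<L::nat}. g u}"
    by (subst card_Diff_subset) (auto intro: finite_subset[of _ "{..<L}"])
  finally show ?thesis .
qed

lemma lossless_slots:
  assumes "K \<ge> 1"
  shows "lossless_spmf (slots K L)"
proof (induction L rule: less_induct)
  case (less L)
  show ?case
  proof (cases "L \<le> K")
    case True
    then show ?thesis by (subst slots.simps) simp
  next
    case False
    let ?G = "Pi_pmf {..<L} False (\<lambda>_. bernoulli_pmf (1/2))"
    let ?c = "\<lambda>g. card {u\<in>{..<L}. g u}"
    define w where "w = weight_spmf (slots K L)"
    have "slots K 0 = return_spmf 1" by (subst slots.simps) simp
    then have w0: "weight_spmf (slots K 0) = 1" by (simp only: weight_return_spmf)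
    have le: "?c g \<le> L" for g using card_mono[of "{..<L}" "{u\<in>{..<L}. g u}"] by auto
    have *: "weight_spmf (slots K i) * weight_spmf (slots K (L - i))
          = w + (1 - w) * of_bool (0 < i \<and> i < L)" if iL: "i \<le> L" for i
    proof -
      consider "i = 0" | "i = L" | "0 < i" "i < L" using iL by linarith
      then show ?thesis
        by cases (use less.IH[of i] less.IH[of "L - i"] False w0 in
            \<open>auto simp: w_def lossless_spmf_def\<close>)
    qed
    have "w = (\<integral>g. weight_spmf (slots K (?c g)) * weight_spmf (slots K (L - ?c g)) \<partial>measure_pmf ?G)"
    proof -
      have "slots K L = bind_spmf (spmf_of_pmf ?G) (\<lambda>g.
           bind_spmf (slots K (?c g)) (\<lambda>t1.
           bind_spmf (slots K (card {u\<in>{..<L}. \<not> g u})) (\<lambda>t2. return_spmf (1 + t1 + t2))))"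
        using False by (subst slots.simps) simp
      then show ?thesis
        unfolding w_def
        by (simp only: weight_bind_spmf o_def card_compl measure_spmf_spmf_of_pmf weight_return_spmf)
           simp
    qed
    also have "\<dots> = w + (1 - w) * measure_pmf.prob ?G {g. 0 < ?c g \<and> ?c g < L}"
    proof -
      have "weight_spmf (slots K (?c g)) * weight_spmf (slots K (L - ?c g))
          = w + (1 - w) * indicator {g. 0 < ?c g \<and> ?c g < L} g" for g
        using *[OF le[of g]] by (simp only: indicator_def mem_Collect_eq)
      then show ?thesis
        by (simp only:) (subst Bochner_Integration.integral_add,
            auto simp: measure_pmf.prob_space intro!: measure_pmf.integrable_const_bound[where B=1])
    qed
    finally have "(1 - w) * measure_pmf.prob ?G {g. 0 < ?c g \<and> ?c g < L} = 0" by simp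
    moreover have "measure_pmf.prob ?G {g. 0 < ?c g \<and> ?c g < L} > 0"
    proof -
      have "(\<lambda>u. u = 0) \<in> set_pmf ?G"
        using False assms by (auto simp: set_Pi_pmf PiE_dflt_def)
      moreover have "{u. u < L \<and> u = 0} = {0}" using False by auto
      then have "(\<lambda>u. u = 0) \<in> {g. 0 < ?c g \<and> ?c g < L}" using False assms by auto
      ultimately show ?thesis by (meson disjoint_iff measure_pmf_posI)
    qed
    ultimately have "w = 1" by auto
    then show ?thesis by (simp add: lossless_spmf_def w_def)
  qed
qed


lemma nn_integral_lub_spmf_le:
  assumes chain: "Complete_Partial_Order.chain (ord_spmf (=)) Y" and Y: "Y \<noteq> {}"
    and le: "\<And>p. p \<in> Y \<Longrightarrow> (\<integral>\<^sup>+x. f x \<partial>measure_spmf p) \<le> c"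
  shows "(\<integral>\<^sup>+x. f x \<partial>measure_spmf (lub_spmf Y)) \<le> c"
proof -
  let ?M = "count_space (set_spmf (lub_spmf Y))"
  have chain': "Complete_Partial_Order.chain (\<le>) ((\<lambda>p x. ennreal (spmf p x) * f x) ` Y)"
    using chain by (rule chain_imageI) (auto simp: le_fun_def dest: ord_spmf_eq_leD intro!: mult_right_mono ennreal_leI)
  have "(\<integral>\<^sup>+x. f x \<partial>measure_spmf (lub_spmf Y)) = (\<integral>\<^sup>+x. (SUP p\<in>Y. ennreal (spmf p x) * f x) \<partial>?M)"
    by (subst nn_integral_measure_spmf', subst ennreal_spmf_lub_spmf[OF chain Y])
       (simp add: SUP_mult_right_ennreal Y)
  also have "\<dots> = (SUP p\<in>Y. \<integral>\<^sup>+x. ennreal (spmf p x) * f x \<partial>?M)"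
    using Y chain' by (rule nn_integral_monotone_convergence_SUP_countable) simp
  also have "\<dots> = (SUP p\<in>Y. \<integral>\<^sup>+x. f x \<partial>measure_spmf p)"
    by (auto simp: nn_integral_measure_spmf nn_integral_count_space_indicator set_lub_spmf[OF chain]
        in_set_spmf_iff_spmf intro!: arg_cong [of _ _ Sup] image_cong nn_integral_cong split: split_indicator)
  also have "\<dots> \<le> c" using le by (rule SUP_least)
  finally show ?thesis .
qed

lemma nn_integral_bind_spmf:
  "(\<integral>\<^sup>+x. f x \<partial>measure_spmf (bind_spmf p h)) = (\<integral>\<^sup>+y. \<integral>\<^sup>+x. f x \<partial>measure_spmf (h y) \<partial>measure_spmf p)"
  unfolding measure_spmf_bind
  by (subst nn_integral_bind[where B="count_space UNIV"]) (auto simp: o_def)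

lemma prob_trivial_split:
  assumes "L \<ge> 2"
  shows "measure_pmf.prob (Pi_pmf {..<L} False (\<lambda>_. bernoulli_pmf (1/2)))
      {g. card {u\<in>{..<L}. g u} \<in> {0, L}} \<le> 1/2"
proof -
  have "measure_pmf.prob (Pi_pmf {..<L} False (\<lambda>_. bernoulli_pmf (1/2)))
      {g. card {u\<in>{..<L}. g u} \<in> {0, L}} = measure_pmf.prob (binomial_pmf L (1/2)) {0, L}"
    by (subst binomial_pmf_altdef'[of "{..<L}" L "1/2" False]) (auto simp: vimage_def)
  also have "\<dots> = 2 * (1/2) ^ L"
    using assms by (subst measure_measure_pmf_finite) (auto simp: pmf_binomial)
  also have "\<dots> \<le> 2 * (1/2) ^ (2::nat)"
    using assms by (intro mult_left_mono power_decreasing) auto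
  finally show ?thesis by (simp add: power2_eq_square)
qed

lemma nn_integral_slots_le:
  assumes "K \<ge> 1"
  shows "(\<integral>\<^sup>+t. ennreal (real t) \<partial>measure_spmf (slots K L)) \<le> ennreal (8 ^ L)"
proof -
  have "\<forall>K\<ge>1. \<forall>L. (\<integral>\<^sup>+t. ennreal (real t) \<partial>measure_spmf (slots K L)) \<le> ennreal (8 ^ L)"
  proof (induction rule: slots.fixp_induct)
    case 1
    show ?case
    proof (intro admissible_all admissible_imp ccpo.admissibleI)
      fix A :: "(nat \<times> nat \<Rightarrow> nat spmf) set" and K L
      assume A: "Complete_Partial_Order.chain spmf.le_fun A" "A \<noteq> {}"
        "\<forall>f\<in>A. (\<integral>\<^sup>+t. ennreal (real t) \<partial>measure_spmf (curry f K L)) \<le> ennreal (8 ^ L)"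
      have "Complete_Partial_Order.chain (ord_spmf (=)) {y. \<exists>f\<in>A. y = f (K, L)}"
        using A(1) by (rule chain_fun)
      then show "(\<integral>\<^sup>+t. ennreal (real t) \<partial>measure_spmf (curry (spmf.lub_fun A) K L)) \<le> ennreal (8 ^ L)"
        unfolding fun_lub_def curry_def by (rule nn_integral_lub_spmf_le) (use A in auto)
    qed
  next
    case 2
    show ?case by simp
  next
    case (3 s)
    show ?case
    proof (intro allI impI)
      fix K L :: nat assume K: "K \<ge> 1"
      let ?G = "Pi_pmf {..<L} False (\<lambda>_. bernoulli_pmf (1/2))"
      let ?c = "\<lambda>g. card {u\<in>{..<L}. g u}"
      let ?B = "bind_spmf (spmf_of_pmf ?G) (\<lambda>g. bind_spmf (s K (?c g)) (\<lambda>t1.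
           bind_spmf (s K (card {u\<in>{..<L}. \<not> g u})) (\<lambda>t2. return_spmf (1 + t1 + t2))))"
      have IH: "(\<integral>\<^sup>+t. ennreal (real t) \<partial>measure_spmf (s K i)) \<le> ennreal (8 ^ i)" for i
        using 3 K by blast
      have L8: "real L \<le> 8 ^ L"
        using less_exp[of L] power_mono[of "2::real" 8 L]
        by (smt (verit) of_nat_less_two_power)
      have step: "(\<integral>\<^sup>+t. ennreal (real t) \<partial>measure_spmf ?B) \<le> ennreal (8 ^ L)" if "L > K"
      proof -
        let ?A = "{g. ?c g \<in> {0, L}}"
        define m where "m = (8::real) ^ (L - 1)"
        have Lm: "8 ^ L = 8 * m" using that by (cases L) (auto simp: m_def)
        have m8: "m \<ge> 8"
          unfolding m_def using that K power_increasing[of 1 "L - 1" "8::real"] by simp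
        have inner: "(\<integral>\<^sup>+t1. \<integral>\<^sup>+t2. ennreal (real (1 + t1 + t2)) \<partial>measure_spmf (s K j) \<partial>measure_spmf (s K i))
            \<le> ennreal (1 + 8 ^ i + 8 ^ j)" for i j
        proof -
          have "(\<integral>\<^sup>+t2. ennreal (real (1 + t1 + t2)) \<partial>measure_spmf (s K j)) \<le> ennreal (1 + 8 ^ j) + ennreal (real t1)" for t1
          proof -
            have "(\<integral>\<^sup>+t2. ennreal (real (1 + t1 + t2)) \<partial>measure_spmf (s K j))
              = (\<integral>\<^sup>+t2. ennreal (1 + real t1) + ennreal (real t2) \<partial>measure_spmf (s K j))"
              by (intro nn_integral_cong) (simp flip: ennreal_plus)
            also have "\<dots> = ennreal (1 + real t1) * emeasure (measure_spmf (s K j)) UNIV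
                + (\<integral>\<^sup>+t2. ennreal (real t2) \<partial>measure_spmf (s K j))"
              by (subst nn_integral_add) (auto simp: space_measure_spmf)
            also have "\<dots> \<le> ennreal (1 + real t1) * 1 + ennreal (8 ^ j)"
              using IH[of j] measure_spmf.subprob_emeasure_le_1[of "s K j" UNIV]
              by (intro add_mono mult_left_mono) auto
            also have "\<dots> = ennreal (1 + 8 ^ j) + ennreal (real t1)"
              by (simp flip: ennreal_plus add: algebra_simps)
            finally show ?thesis .
          qed
          then have "(\<integral>\<^sup>+t1. \<integral>\<^sup>+t2. ennreal (real (1 + t1 + t2)) \<partial>measure_spmf (s K j) \<partial>measure_spmf (s K i))
             \<le> (\<integral>\<^sup>+t1. ennreal (1 + 8 ^ j) + ennreal (real t1) \<partial>measure_spmf (s K i))"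
            by (intro nn_integral_mono)
          also have "\<dots> = ennreal (1 + 8 ^ j) * emeasure (measure_spmf (s K i)) UNIV
                + (\<integral>\<^sup>+t1. ennreal (real t1) \<partial>measure_spmf (s K i))"
            by (subst nn_integral_add) (auto simp: space_measure_spmf)
          also have "\<dots> \<le> ennreal (1 + 8 ^ j) * 1 + ennreal (8 ^ i)"
            using IH[of i] measure_spmf.subprob_emeasure_le_1[of "s K i" UNIV]
            by (intro add_mono mult_left_mono) auto
          also have "\<dots> = ennreal (1 + 8 ^ i + 8 ^ j)"
            by (simp flip: ennreal_plus add: algebra_simps)
          finally show ?thesis .
        qed
        have ptw: "1 + 8 ^ i + 8 ^ (L - i) \<le> 2 + 2 * m + 8 * m * of_bool (i \<in> {0, L})"
          if iL: "i \<le> L" for i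
        proof -
          consider "i = 0 \<or> i = L" | "0 < i" "i < L" using iL by linarith
          then show ?thesis
          proof cases
            case 2
            have "(8::real) ^ i \<le> m" "(8::real) ^ (L - i) \<le> m"
              unfolding m_def using 2 by (auto intro!: power_increasing)
            then show ?thesis using 2 m8 by simp
          qed (use Lm m8 in auto)
        qed
        have cL: "?c g \<le> L" for g
          using card_mono[of "{..<L}" "{u\<in>{..<L}. g u}"] by auto
        have "(\<integral>\<^sup>+t. ennreal (real t) \<partial>measure_spmf ?B)
            = (\<integral>\<^sup>+g. \<integral>\<^sup>+t1. \<integral>\<^sup>+t2. ennreal (real (1 + t1 + t2)) \<partial>measure_spmf (s K (L - ?c g)) \<partial>measure_spmf (s K (?c g)) \<partial>measure_pmf ?G)"
          by (simp only: nn_integral_bind_spmf card_compl measure_spmf_spmf_of_pmf)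
             (simp add: measure_spmf_return_spmf nn_integral_return)
        also have "\<dots> \<le> (\<integral>\<^sup>+g. ennreal (2 + 2 * m) + ennreal (8 * m) * indicator ?A g \<partial>measure_pmf ?G)"
        proof (intro nn_integral_mono order.trans[OF inner])
          fix g
          have "ennreal (1 + 8 ^ ?c g + 8 ^ (L - ?c g)) \<le> ennreal (2 + 2 * m + 8 * m * indicator ?A g)"
            using ptw[OF cL[of g]] by (intro ennreal_leI) (simp only: indicator_def mem_Collect_eq)
          also have "\<dots> = ennreal (2 + 2 * m) + ennreal (8 * m) * indicator ?A g"
            using m8 by (subst ennreal_plus) (auto simp: indicator_def)
          finally show "ennreal (1 + 8 ^ ?c g + 8 ^ (L - ?c g)) \<le> \<dots>" .
        qed
        also have "\<dots> = ennreal (2 + 2 * m) + ennreal (8 * m) * emeasure (measure_pmf ?G) ?A"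
          by (subst nn_integral_add) (auto simp: nn_integral_cmult_indicator)
        also have "\<dots> \<le> ennreal (2 + 2 * m) + ennreal (8 * m) * ennreal (1/2)"
          unfolding measure_pmf.emeasure_eq_measure using that K
          by (intro add_mono mult_left_mono order.refl ennreal_leI prob_trivial_split) auto
        also have "\<dots> = ennreal (2 + 6 * m)"
          using m8 by (subst ennreal_mult[symmetric], simp, simp, subst ennreal_plus[symmetric]) auto
        also have "\<dots> \<le> ennreal (8 ^ L)" using m8 Lm by (intro ennreal_leI) simp
        finally show ?thesis .
      qed
      show "(\<integral>\<^sup>+t. ennreal (real t) \<partial>measure_spmf
             (if L = 0 then return_spmf 1 else if L \<le> K then return_spmf L else ?B)) \<le> ennreal (8 ^ L)"
        using step L8 by (auto simp: measure_spmf_return_spmf nn_integral_return)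
    qed
  qed
  then show ?thesis using assms by blast
qed

lemma integrable_slots:
  assumes "K \<ge> 1"
  shows "integrable (measure_spmf (slots K L)) real"
proof (rule integrableI_bounded)
  show "(\<integral>\<^sup>+t. ennreal (norm (real t)) \<partial>measure_spmf (slots K L)) < \<infinity>"
    using nn_integral_slots_le[OF assms, of L] by (simp add: le_less_trans[OF _ ennreal_less_top])
qed simp

definition mean_slots :: "nat \<Rightarrow> nat \<Rightarrow> real" where
  "mean_slots K L = integral\<^sup>L (measure_spmf (slots K L)) real"

definition log2_plus :: "real \<Rightarrow> real" where
  "log2_plus x = (if x \<ge> 1 then log 2 x else 0)"

definition active_prob :: "nat \<Rightarrow> real \<Rightarrow> nat \<Rightarrow> real" where
  "active_prob M p L = real (M choose L) * p ^ L * (1 - p) ^ (M - L)"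

definition cond_active_prob :: "nat \<Rightarrow> real \<Rightarrow> nat \<Rightarrow> real" where
  "cond_active_prob M p L = active_prob M p L / (1 - active_prob M p 0)"

definition signature_length :: "nat \<Rightarrow> nat \<Rightarrow> nat \<Rightarrow> int" where
  "signature_length K M N =
     \<lceil>real K * log 2 (real M) / (log 2 (real N * log 2 (real N) - 1) - log 2 (real K))\<rceil> + 1"

definition message_bits :: "nat \<Rightarrow> real \<Rightarrow> int \<Rightarrow> real" where
  "message_bits N P Nw =
     real N / 2 * log2_plus P - real_of_int Nw * log 2 (real N * log 2 (real N))"

definition net_rate :: "nat \<Rightarrow> real \<Rightarrow> nat \<Rightarrow> nat \<Rightarrow> real" where
  "net_rate N D K L = real L * D / (mean_slots K L * real N)"

definition avg_net_rate :: "nat \<Rightarrow> real \<Rightarrow> nat \<Rightarrow> nat \<Rightarrow> real \<Rightarrow> real" where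
  "avg_net_rate N D K M p = (\<Sum>L=1..M. net_rate N D K L * cond_active_prob M p L)"

definition beta_star :: "nat \<Rightarrow> real" where
  "beta_star K = 1 + 2 / ((real K + 1) * (1 - 2 powr (- real K)))"

definition inc_beta :: "real \<Rightarrow> real \<Rightarrow> real \<Rightarrow> real" where
  "inc_beta x a b = integral {0..x} (\<lambda>t. t powr (a - 1) * (1 - t) powr (b - 1))"

text \<open>
  For \<open>b = 0\<close> the complete integral diverges; the value \<open>0\<close> is the limit as \<open>b \<rightarrow> 0+\<close>
  for \<open>x < 1\<close>.
\<close>

definition reg_inc_beta :: "real \<Rightarrow> real \<Rightarrow> real \<Rightarrow> real" where
  "reg_inc_beta x a b = (if b = 0 then 0 else inc_beta x a b / inc_beta 1 a b)"

end

theory Submission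
  imports Defs
begin

text \<open>
  Write \<open>S\<close> for \<open>mean_slots K\<close> and \<open>\<beta>\<close> for \<open>beta_star K\<close>. The function \<open>h L = \<beta> L - 1\<close> satisfies
  the same recurrence \<open>2^L S(L) = 2^L + 2 \<Sum>\<^sub>i (L choose i) S(i)\<close> as \<open>S\<close>, so the difference
  \<open>d = S - h\<close> satisfies the homogeneous one, and \<open>d L \<le> 0\<close> for \<open>L > K\<close> follows by induction as
  soon as the initial values contribute \<open>\<Sum>\<^sub>i\<^sub>\<le>\<^sub>K (L choose i) d(i) \<le> 0\<close>. At \<open>L = K + 1\<close> this is an
  equality, which is what determines \<open>\<beta>\<close>; Pascal's rule propagates it to larger \<open>L\<close>.
  Hence \<open>L / S(L) \<ge> 1 / \<beta>\<close> for \<open>L > K\<close>, whereas \<open>L / S(L) = 1\<close> for \<open>1 \<le> L \<le> K\<close>, and the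
  incomplete beta function is the probability that more than \<open>K\<close> users are active.
\<close>

section \<open>Initial values and recurrence of the mean number of slots\<close>

lemma mean_slots_small:
  shows "mean_slots K 0 = 1" and "1 \<le> L \<Longrightarrow> L \<le> K \<Longrightarrow> mean_slots K L = real L"
  by (simp_all add: mean_slots_def slots.simps[of K L] slots.simps[of K 0]
      measure_spmf_return_spmf integral_return)

lemma mean_slots_nonneg: "mean_slots K L \<ge> 0"
  by (simp add: mean_slots_def)

text \<open>Nonnegative integrals pass through \<open>bind_spmf\<close> without integrability
  conditions; finiteness of the mean then leads back to the reals.\<close>

lemma nn_integral_slots:
  assumes "K \<ge> 1"
  shows "(\<integral>\<^sup>+t. ennreal (real t) \<partial>measure_spmf (slots K L)) = ennreal (mean_slots K L)"
  unfolding mean_slots_def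
  by (rule nn_integral_eq_integral) (use integrable_slots[OF assms] in auto)

text \<open>The constant integrates to itself because no mass is lost
  (\<open>lossless_slots\<close>).\<close>

lemma nn_integral_slots_add:
  assumes "K \<ge> 1" and "c \<ge> 0"
  shows "(\<integral>\<^sup>+t. ennreal (c + real t) \<partial>measure_spmf (slots K L)) = ennreal (c + mean_slots K L)"
proof -
  have "emeasure (measure_spmf (slots K L)) UNIV = 1"
    using lossless_slots[OF assms(1), of L]
    by (simp add: lossless_spmf_def weight_spmf_def measure_spmf.emeasure_eq_measure space_measure_spmf)
  then show ?thesis
    using assms(2)
    by (simp add: nn_integral_add nn_integral_slots[OF assms(1)] mean_slots_nonneg
        ennreal_plus space_measure_spmf)
qed

text \<open>Condition on the size \<open>i\<close> of group 1, which is binomial with parameters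
  \<open>L\<close> and 1/2. Reflecting \<open>i\<close> to \<open>L - i\<close> shows that both
  groups contribute equally, hence the factor 2. The term \<open>i = L\<close> stays in the sum, so
  \<open>mean_slots K L\<close> occurs on both sides.\<close>

lemma mean_slots_rec:
  assumes "K \<ge> 1" and "L > K"
  shows "2 ^ L * mean_slots K L = 2 ^ L + 2 * (\<Sum>i\<le>L. real (L choose i) * mean_slots K i)"
proof -
  let ?S = "mean_slots K"
  let ?G = "Pi_pmf {..<L} False (\<lambda>_. bernoulli_pmf (1/2))"
  let ?c = "\<lambda>g. card {u\<in>{..<L}. g u}"
  have inner: "(\<integral>\<^sup>+t1. \<integral>\<^sup>+t2. ennreal (real (1 + t1 + t2)) \<partial>measure_spmf (slots K j) \<partial>measure_spmf (slots K i))
      = ennreal (1 + ?S i + ?S j)" for i j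
  proof -
    have "(\<integral>\<^sup>+t2. ennreal (real (1 + t1 + t2)) \<partial>measure_spmf (slots K j))
        = ennreal ((1 + ?S j) + real t1)" for t1
      using nn_integral_slots_add[OF assms(1), of "1 + real t1" j] by (simp add: add_ac)
    then show ?thesis
      using nn_integral_slots_add[OF assms(1), of "1 + ?S j" i]
      by (simp only:) (simp add: add_ac mean_slots_nonneg)
  qed
  have "slots K L = bind_spmf (spmf_of_pmf ?G) (\<lambda>g.
       bind_spmf (slots K (?c g)) (\<lambda>t1.
       bind_spmf (slots K (card {u\<in>{..<L}. \<not> g u})) (\<lambda>t2. return_spmf (1 + t1 + t2))))"
    using assms by (subst slots.simps) simp
  then have "ennreal (?S L) = (\<integral>\<^sup>+g. \<integral>\<^sup>+t1. \<integral>\<^sup>+t2. ennreal (real (1 + t1 + t2))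
      \<partial>measure_spmf (slots K (L - ?c g)) \<partial>measure_spmf (slots K (?c g)) \<partial>measure_pmf ?G)"
    unfolding nn_integral_slots[OF assms(1), symmetric]
    by (simp only: nn_integral_bind_spmf card_compl measure_spmf_spmf_of_pmf)
       (simp add: measure_spmf_return_spmf nn_integral_return)
  also have "\<dots> = (\<integral>\<^sup>+g. ennreal (1 + ?S (?c g) + ?S (L - ?c g)) \<partial>measure_pmf ?G)"
    by (simp only: inner)
  also have "\<dots> = (\<integral>\<^sup>+i. ennreal (1 + ?S i + ?S (L - i)) \<partial>measure_pmf (binomial_pmf L (1/2)))"
    by (subst binomial_pmf_altdef'[of "{..<L}" L "1/2" False]) auto
  also have "\<dots> = (\<Sum>i\<le>L. ennreal (1 + ?S i + ?S (L - i)) * ennreal (pmf (binomial_pmf L (1/2)) i))"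
    by (rule nn_integral_measure_pmf_support) (auto simp: set_pmf_eq pmf_binomial)
  also have "\<dots> = ennreal (\<Sum>i\<le>L. (1 + ?S i + ?S (L - i)) * pmf (binomial_pmf L (1/2)) i)"
    by (subst sum_ennreal[symmetric], intro mult_nonneg_nonneg)
       (auto intro!: sum.cong add_nonneg_nonneg simp: mean_slots_nonneg ennreal_mult'
          simp del: ennreal_plus pmf_binomial)
  finally have "?S L = (\<Sum>i\<le>L. (1 + ?S i + ?S (L - i)) * pmf (binomial_pmf L (1/2)) i)"
    by (subst (asm) ennreal_inj) (auto intro!: sum_nonneg mult_nonneg_nonneg simp: mean_slots_nonneg)
  also have "\<dots> = (\<Sum>i\<le>L. (1 + ?S i + ?S (L - i)) * real (L choose i) / 2 ^ L)"
    by (intro sum.cong refl) (auto simp: pmf_binomial power_one_over power_add[symmetric] field_simps)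
  finally have "2 ^ L * ?S L = (\<Sum>i\<le>L. (1 + ?S i + ?S (L - i)) * real (L choose i))"
    by (simp add: sum_divide_distrib[symmetric])
  also have "\<dots> = (\<Sum>i\<le>L. real (L choose i)) + (\<Sum>i\<le>L. real (L choose i) * ?S i)
      + (\<Sum>i\<le>L. real (L choose i) * ?S (L - i))"
    by (simp add: algebra_simps sum.distrib)
  also have "(\<Sum>i\<le>L. real (L choose i) * ?S (L - i)) = (\<Sum>i\<le>L. real (L choose i) * ?S i)"
    by (rule sum.reindex_bij_witness[of _ "\<lambda>i. L - i" "\<lambda>i. L - i"]) (auto simp: binomial_symmetric[symmetric])
  also have "(\<Sum>i\<le>L. real (L choose i)) = 2 ^ L"
    using choose_row_sum[of L] by (simp flip: of_nat_sum)
  finally show ?thesis by simp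
qed

section \<open>Linear upper bound on the mean\<close>

text \<open>
  Pairing \<open>i\<close> with \<open>n - i\<close>: the index farther to the right carries the larger coefficient.
\<close>
lemma sum_choose_centered_nonneg:
  assumes "n \<le> L"
  shows "(\<Sum>i\<le>n. real (L choose i) * (2 * real i - real n)) \<ge> 0"
proof -
  let ?b = "\<lambda>i. real (L choose i)"
  have "(\<Sum>i\<le>n. ?b i * (2 * real i - real n)) = (\<Sum>i\<le>n. ?b (n - i) * (2 * real (n - i) - real n))"
    by (rule sum.reindex_bij_witness[of _ "\<lambda>i. n - i" "\<lambda>i. n - i"]) auto
  then have "2 * (\<Sum>i\<le>n. ?b i * (2 * real i - real n))
      = (\<Sum>i\<le>n. ?b i * (2 * real i - real n)) + (\<Sum>i\<le>n. ?b (n - i) * (2 * real (n - i) - real n))"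
    by simp
  also have "\<dots> = (\<Sum>i\<le>n. (?b i - ?b (n - i)) * (2 * real i - real n))"
    unfolding sum.distrib[symmetric]
    by (intro sum.cong refl) (auto simp: of_nat_diff algebra_simps)
  also have "\<dots> \<ge> 0"
  proof (intro sum_nonneg)
    have *: "L choose i \<le> L choose j" if "i \<le> j" "i + j \<le> n" for i j
    proof (cases "2 * j \<le> L")
      case True
      then show ?thesis using that binomial_mono by blast
    next
      \<comment> \<open>Past the middle of the row, \<open>j\<close> is reflected to
        \<open>L - j\<close>, which is still at least \<open>i\<close> because
        \<open>i + j \<le> n \<le> L\<close>.\<close>
      case False
      have "L choose i \<le> L choose (L - j)" using that assms False by (intro binomial_mono) auto
      also have "L choose (L - j) = L choose j" using that assms by (intro binomial_symmetric[symmetric]) auto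
      finally show ?thesis .
    qed
    fix i assume "i \<in> {..n}"
    then show "0 \<le> (?b i - ?b (n - i)) * (2 * real i - real n)"
      using *[of i "n - i"] *[of "n - i" i]
      by (cases "2 * i \<le> n") (auto intro!: mult_nonneg_nonneg mult_nonpos_nonpos)
  qed
  finally show ?thesis by simp
qed

text \<open>The first bound serves the Pascal step of \<open>sum_choose_beta_star_nonpos\<close>;
  the last, with denominators cleared, gives equality in its base case.\<close>

lemma beta_star_bounds:
  assumes "K \<ge> 1"
  shows "beta_star K - 1 \<ge> 2 / (real K + 1)" and "beta_star K > 1"
    and "(beta_star K - 1) * ((real K + 1) * (2 ^ K - 1)) = 2 ^ Suc K"
proof -
  have K: "(2::real) ^ K > 1" using assms by simp
  have e: "2 powr (- real K) = 1 / 2 ^ K" by (simp add: powr_minus powr_realpow inverse_eq_divide)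
  define u where "u = 1 - 2 powr (- real K)"
  have u: "0 < u" "u \<le> 1" "u * 2 ^ K = 2 ^ K - 1" using K by (auto simp: u_def e field_simps)
  have b: "beta_star K - 1 = 2 / ((real K + 1) * u)" by (simp add: beta_star_def u_def)
  show "beta_star K - 1 \<ge> 2 / (real K + 1)"
    unfolding b using u by (intro divide_left_mono) (auto simp: mult_left_le)
  show "beta_star K > 1" using b u by (smt (verit) divide_pos_pos mult_pos_pos of_nat_0_le_iff)
  show "(beta_star K - 1) * ((real K + 1) * (2 ^ K - 1)) = 2 ^ Suc K"
  proof -
    have "(real K + 1) * u \<noteq> 0" using u(1) by simp
    then show ?thesis unfolding b u(3)[symmetric] by (simp add: divide_eq_eq)
  qed
qed

text \<open>This is the contribution of the initial differences \<open>d i\<close>: they equal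
  \<open>1 - (beta_star K - 1) * i\<close> for \<open>1 \<le> i \<le> K\<close>, but
  \<open>d 0 = 2\<close> exceeds that formula by one, whence the leading 1.\<close>

lemma sum_choose_beta_star_nonpos:
  assumes "K \<ge> 1" and "L \<ge> Suc K"
  shows "1 + (\<Sum>i\<le>K. real (L choose i) * (1 - (beta_star K - 1) * real i)) \<le> 0"
  using assms(2)
proof (induction L rule: dec_induct)
  case base
  let ?g = "beta_star K - 1"
  \<comment> \<open>\<open>s\<close> and \<open>t\<close> are the known sums over the full row, less
    the last term \<open>i = Suc K\<close>.\<close>
  have s: "(\<Sum>i\<le>K. real (Suc K choose i)) = 2 ^ Suc K - 1"
    using arg_cong[OF choose_row_sum[of "Suc K"], of real] by simp
  have "(\<Sum>i\<le>Suc K. real i * real (Suc K choose i)) = real (Suc K) * 2 ^ K"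
    using arg_cong[OF choose_linear_sum[of "Suc K"], of real]
    by (simp del: sum.atMost_Suc binomial_Suc_Suc of_nat_Suc mult_Suc)
  then have t: "(\<Sum>i\<le>K. real i * real (Suc K choose i)) = (real K + 1) * (2 ^ K - 1)"
    unfolding sum.atMost_Suc binomial_n_n of_nat_Suc of_nat_1 by (simp add: right_diff_distrib add_ac)
  have "(\<Sum>i\<le>K. real (Suc K choose i) * (1 - ?g * real i))
      = (\<Sum>i\<le>K. real (Suc K choose i)) - ?g * (\<Sum>i\<le>K. real i * real (Suc K choose i))"
    by (simp add: algebra_simps sum_subtractf sum.distrib sum_distrib_left del: binomial_Suc_Suc)
  then show ?case unfolding s t beta_star_bounds(3)[OF assms(1)] by simp
next
  case (step L)
  define g where "g = beta_star K - 1"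
  obtain k where k: "K = Suc k" using assms(1) by (cases K) auto
  \<comment> \<open>Pascal's rule; the second part is shifted by one index and so ends at
    \<open>k = K - 1\<close>.\<close>
  have "(\<Sum>i\<le>K. real (Suc L choose i) * (1 - g * real i))
      = (\<Sum>i\<le>K. real (L choose i) * (1 - g * real i)) + (\<Sum>i\<le>k. real (L choose i) * (1 - g * real (Suc i)))"
    unfolding k sum.atMost_Suc_shift by (simp add: distrib_right sum.distrib)
  moreover have "(\<Sum>i\<le>k. real (L choose i) * (1 - g * real (Suc i))) \<le> 0"
  proof -
    have g: "g \<ge> 2 / (real K + 1)" using beta_star_bounds[OF assms(1)] by (simp add: g_def)
    \<comment> \<open>Since \<open>K + 1 = k + 2\<close>, replacing \<open>g\<close> by its lower
      bound turns the weight into a negative multiple of \<open>2 * i - k\<close>, the weight of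
      \<open>sum_choose_centered_nonneg\<close>.\<close>
    have "(\<Sum>i\<le>k. real (L choose i) * (1 - g * real (Suc i)))
        \<le> (\<Sum>i\<le>k. - (1 / (real K + 1)) * (real (L choose i) * (2 * real i - real k)))"
    proof (intro sum_mono)
      fix i
      have "1 - g * real (Suc i) \<le> 1 - 2 / (real K + 1) * real (Suc i)"
        using g by (intro diff_left_mono mult_right_mono) auto
      also have "\<dots> = - (1 / (real K + 1)) * (2 * real i - real k)"
        by (simp add: k field_simps)
      finally show "real (L choose i) * (1 - g * real (Suc i))
          \<le> - (1 / (real K + 1)) * (real (L choose i) * (2 * real i - real k))"
        by (metis mult.left_commute mult_left_mono of_nat_0_le_iff)
    qed
    also have "\<dots> = - (1 / (real K + 1)) * (\<Sum>i\<le>k. real (L choose i) * (2 * real i - real k))"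
      by (rule sum_distrib_left[symmetric])
    also have "\<dots> \<le> 0"
      using sum_choose_centered_nonneg[of k L] step k by (intro mult_nonpos_nonneg) auto
    finally show ?thesis .
  qed
  ultimately show ?case using step.IH by (simp add: g_def)
qed

lemma mean_slots_le:
  assumes "K \<ge> 1" and "L > K"
  shows "mean_slots K L \<le> beta_star K * real L - 1"
  using assms(2)
proof (induction L rule: less_induct)
  case (less L)
  define d where "d i = mean_slots K i - (beta_star K * real i - 1)" for i
  have L: "L \<ge> 2" using assms(1) less.prems by simp
  have c: "(\<Sum>i\<le>L. real (L choose i)) = 2 ^ L"
    using choose_row_sum[of L] by (simp flip: of_nat_sum)
  have l: "2 * (\<Sum>i\<le>L. real i * real (L choose i)) = real L * 2 ^ L"
    using arg_cong[OF choose_linear_sum[of L], of real] L power_Suc[of "2::real" "L - 1"] by simp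
  have "(\<Sum>i\<le>L. real (L choose i) * d i) = (\<Sum>i\<le>L. real (L choose i) * mean_slots K i)
      - beta_star K * (\<Sum>i\<le>L. real i * real (L choose i)) + (\<Sum>i\<le>L. real (L choose i))"
    by (simp add: d_def algebra_simps sum_subtractf sum.distrib sum_distrib_left)
  moreover have "2 * (beta_star K * (\<Sum>i\<le>L. real i * real (L choose i))) = beta_star K * (real L * 2 ^ L)"
    by (simp flip: l)
  moreover have "2 ^ L * d L = 2 ^ L * mean_slots K L - beta_star K * (real L * 2 ^ L) + 2 ^ L"
    by (simp add: d_def algebra_simps)
  ultimately have rec: "2 ^ L * d L = 2 * (\<Sum>i\<le>L. real (L choose i) * d i)"
    using mean_slots_rec[OF assms(1) less.prems] c by linarith
  \<comment> \<open>The term \<open>i = L\<close> is isolated: moved to the left of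
    \<open>rec\<close>, it leaves \<open>d L\<close> with the positive factor
    \<open>2 ^ L - 2\<close>.\<close>
  have split: "{..L} = insert L ({..K} \<union> {K<..<L})" using less.prems by auto
  have "(\<Sum>i\<le>L. real (L choose i) * d i)
      = d L + ((\<Sum>i\<le>K. real (L choose i) * d i) + (\<Sum>i\<in>{K<..<L}. real (L choose i) * d i))"
    unfolding split using less.prems by (subst sum.insert) (auto intro!: sum.union_disjoint)
  moreover have "(\<Sum>i\<in>{K<..<L}. real (L choose i) * d i) \<le> 0"
    using less.IH by (intro sum_nonpos mult_nonneg_nonpos) (auto simp: d_def)
  moreover have "(\<Sum>i\<le>K. real (L choose i) * d i) \<le> 0"
  proof -
    have "(\<Sum>i\<le>K. real (L choose i) * d i)
        = (\<Sum>i\<le>K. real (L choose i) * (1 - (beta_star K - 1) * real i) + of_bool (i = 0))"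
      by (intro sum.cong refl) (auto simp: d_def mean_slots_small algebra_simps)
    also have "\<dots> = 1 + (\<Sum>i\<le>K. real (L choose i) * (1 - (beta_star K - 1) * real i))"
      by (simp add: sum.distrib of_bool_def)
    also have "\<dots> \<le> 0" using less.prems assms(1) by (intro sum_choose_beta_star_nonpos) auto
    finally show ?thesis .
  qed
  ultimately have "(2 ^ L - 2) * d L \<le> 0" using rec by (simp add: algebra_simps)
  moreover have "(2::real) ^ L - 2 > 0"
    using power_increasing[OF L, of "2::real"] by simp
  ultimately have "d L \<le> 0" by (simp add: mult_le_0_iff)
  then show ?case by (simp add: d_def)
qed

text \<open>For \<open>L > K\<close> the term \<open>2 ^ L\<close> of the recurrence, due to the
  collision slot, forces positivity.\<close>

lemma mean_slots_pos:
  assumes "K \<ge> 1"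
  shows "mean_slots K L > 0"
proof -
  consider "L = 0" | "1 \<le> L" "L \<le> K" | "L > K" by linarith
  then show ?thesis
  proof cases
    case 3
    have "(\<Sum>i\<le>L. real (L choose i) * mean_slots K i) \<ge> 0"
      by (intro sum_nonneg mult_nonneg_nonneg) (auto simp: mean_slots_nonneg)
    then have "2 ^ L * mean_slots K L > 0"
      unfolding mean_slots_rec[OF assms 3] by (smt (verit) zero_less_power)
    then show ?thesis by (simp add: zero_less_mult_iff)
  qed (auto simp: mean_slots_small)
qed

section \<open>Binomial tails as incomplete beta functions\<close>

text \<open>By the absorption identities each term has derivative \<open>b l - b (Suc l)\<close>, so
  the sum telescopes; only \<open>b k\<close> survives, as \<open>b (Suc m) = 0\<close>.\<close>

lemma DERIV_binomial_tail:
  fixes t :: real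
  assumes "k \<le> m"
  shows "((\<lambda>t. \<Sum>l=k..m. real (Suc m choose Suc l) * t ^ Suc l * (1 - t) ^ (m - l))
    has_real_derivative real (Suc m) * real (m choose k) * t ^ k * (1 - t) ^ (m - k))
    (at t within A)"
proof -
  define b where "b l = real (Suc m) * real (m choose l) * t ^ l * (1 - t) ^ (m - l)" for l
  have deriv: "((\<lambda>t. c * t ^ n * (1 - t) ^ j) has_real_derivative
      c * real n * t ^ (n - 1) * (1 - t) ^ j - c * real j * t ^ n * (1 - t) ^ (j - 1)) (at t within A)"
    for c :: real and n j
    by (auto intro!: derivative_eq_intros simp: algebra_simps)
  have "((\<lambda>t. real (Suc m choose Suc l) * t ^ Suc l * (1 - t) ^ (m - l))
      has_real_derivative (b l - b (Suc l))) (at t within A)" if "l \<le> m" for l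
  proof -
    have 1: "real (Suc m choose Suc l) * real (Suc l) = real (Suc m) * real (m choose l)"
      by (metis Suc_times_binomial mult.commute of_nat_mult)
    have 2: "real (Suc m choose Suc l) * real (m - l) = real (Suc m) * real (m choose Suc l)"
    proof -
      have "(Suc m - Suc l) * (Suc m choose Suc l) = Suc m * (m choose Suc l)"
        by (metis binomial_absorb_comp diff_Suc_1)
      then show ?thesis by (metis diff_Suc_Suc mult.commute of_nat_mult)
    qed
    have "((\<lambda>t. real (Suc m choose Suc l) * t ^ Suc l * (1 - t) ^ (m - l)) has_real_derivative
        (real (Suc m choose Suc l) * real (Suc l)) * t ^ l * (1 - t) ^ (m - l)
        - (real (Suc m choose Suc l) * real (m - l)) * t ^ Suc l * (1 - t) ^ (m - l - 1)) (at t within A)"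
      using deriv[of "real (Suc m choose Suc l)" "Suc l" "m - l"] by (simp only: diff_Suc_1 mult_ac)
    then show ?thesis unfolding 1 2 b_def by simp
  qed
  then have "((\<lambda>t. \<Sum>l=k..m. real (Suc m choose Suc l) * t ^ Suc l * (1 - t) ^ (m - l))
      has_real_derivative (\<Sum>l=k..m. b l - b (Suc l))) (at t within A)"
    by (intro DERIV_sum) auto
  also have "(\<Sum>l=k..m. b l - b (Suc l)) = b k"
    using assms sum_Suc_diff[of k m "\<lambda>l. - b l"] by (simp add: b_def)
  finally show ?thesis unfolding b_def .
qed

lemma inc_beta_binomial_tail:
  assumes "1 \<le> k" and "k \<le> m" and "0 \<le> x" and "x \<le> 1"
  shows "real (Suc m) * real (m choose k) * inc_beta x (real k + 1) (real (Suc m) - real k)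
    = (\<Sum>l=k..m. real (Suc m choose Suc l) * x ^ Suc l * (1 - x) ^ (m - l))"
proof -
  let ?F = "\<lambda>t::real. \<Sum>l=k..m. real (Suc m choose Suc l) * t ^ Suc l * (1 - t) ^ (m - l)"
  let ?f = "\<lambda>t::real. t powr (real k + 1 - 1) * (1 - t) powr (real (Suc m) - real k - 1)"
  let ?c = "real (Suc m) * real (m choose k)"
  have "((\<lambda>t. ?c * t ^ k * (1 - t) ^ (m - k)) has_integral (?F x - ?F 0)) {0..x}"
    by (rule fundamental_theorem_of_calculus[OF assms(3)])
       (rule DERIV_binomial_tail[OF assms(2),
          unfolded has_real_derivative_iff_has_vector_derivative])
  then have "((\<lambda>t. ?c * ?f t) has_integral (?F x - ?F 0)) {0..x}"
  \<comment> \<open>The endpoints are excluded because \<open>0 powr 0 = 0\<close> while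
    \<open>0 ^ 0 = 1\<close>: for \<open>k = m\<close> the integrands differ at
    \<open>t = 1\<close>.\<close>
  proof (rule has_integral_spike_finite[where S = "{0, 1}", rotated 2])
    fix t assume t: "t \<in> {0..x} - {0, 1}"
    then have "0 < t" "t < 1" using assms by auto
    then show "?c * ?f t = ?c * t ^ k * (1 - t) ^ (m - k)"
      using assms by (simp add: powr_realpow of_nat_diff[symmetric] del: of_nat_diff)
  qed simp
  then have "integral {0..x} (\<lambda>t. ?c * ?f t) = ?F x - ?F 0" by (rule integral_unique)
  then show ?thesis unfolding inc_beta_def by simp
qed

lemma reg_inc_beta_binomial_tail:
  assumes "1 \<le> K" and "K \<le> M" and "0 \<le> p" and "p \<le> 1"
  shows "reg_inc_beta p (real K + 1) (real M - real K) = (\<Sum>L=Suc K..M. active_prob M p L)"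
proof (cases "K = M")
  case True
  \<comment> \<open>The convention for second parameter 0 meets an empty sum.\<close>
  then show ?thesis by (simp add: reg_inc_beta_def)
next
  case False
  then obtain m where m: "M = Suc m" "K \<le> m" using assms(2) by (cases M) auto
  let ?c = "real (Suc m) * real (m choose K)"
  let ?B = "\<lambda>x. inc_beta x (real K + 1) (real (Suc m) - real K)"
  \<comment> \<open>At \<open>x = 1\<close> only \<open>l = m\<close> survives, so \<open>?c\<close>
    is the reciprocal of the complete beta integral.\<close>
  have "?c * ?B 1 = (\<Sum>l=K..m. real (Suc m choose Suc l) * 1 ^ Suc l * (1 - 1) ^ (m - l))"
    using assms m by (intro inc_beta_binomial_tail) auto
  also have "\<dots> = (\<Sum>l=K..m. if l = m then 1 else 0)"
    by (intro sum.cong refl) auto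
  finally have "?c * ?B 1 = 1" using m by simp
  then have "?B p / ?B 1 = ?c * ?B p" by (cases "?B 1 = 0") (simp_all add: divide_eq_eq mult_ac)
  also have "\<dots> = (\<Sum>l=K..m. real (Suc m choose Suc l) * p ^ Suc l * (1 - p) ^ (m - l))"
    using assms m by (intro inc_beta_binomial_tail) auto
  also have "\<dots> = (\<Sum>L=Suc K..M. active_prob M p L)"
    unfolding m sum.shift_bounds_cl_Suc_ivl by (simp add: active_prob_def)
  finally show ?thesis using m by (simp add: reg_inc_beta_def)
qed

section \<open>Averaging over the number of active users\<close>

lemma sum_active_prob: "(\<Sum>L\<le>M. active_prob M p L) = 1"
  using binomial_ring[of p "1 - p" M] by (simp add: active_prob_def)

theorem corollary2:
  fixes M K N :: nat and p P :: real
  assumes "M \<ge> 1" and "1 \<le> K" and "K \<le> M"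
    and "0 < p" and "p < 1" and "P > 1"
    and "real N * log 2 (real N) - 1 > real K"
    and "real M \<le> real N * log 2 (real N) - 1"
    and "message_bits N P (signature_length K M N) \<ge> 0"
  shows "avg_net_rate N (message_bits N P (signature_length K M N)) K M p
    \<ge> (1/2 * log2_plus P
          - real_of_int (signature_length K M N) / real N * log 2 (real N * log 2 (real N)))
      * (1 - (beta_star K - 1) / (beta_star K * (1 - (1 - p) ^ M))
             * reg_inc_beta p (real K + 1) (real M - real K))"
proof -
  define D where "D = message_bits N P (signature_length K M N)"
  define b where "b = beta_star K"
  define q where "q = active_prob M p"
  define T where "T = (\<Sum>L=Suc K..M. q L)"
  \<comment> \<open>\<open>c = 1 - 1 / b\<close> is the loss charged when \<open>L > K\<close>, and
    \<open>e\<close> marks these \<open>L\<close>.\<close>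
  define c where "c = (b - 1) / b"
  define e :: "nat \<Rightarrow> real" where "e L = of_bool (L > K)" for L
  define Z where "Z = 1 - (1 - p) ^ M"
  have N: "real N > 0" using assms(7) by (cases "N = 0") auto
  \<comment> \<open>This sign lets the lower bound on each \<open>L / mean_slots K L\<close> be
    scaled by \<open>D / N\<close>.\<close>
  have D: "D / N \<ge> 0" using assms(9) N by (simp add: D_def)
  have b: "b > 1" using beta_star_bounds(2)[OF assms(2)] by (simp add: b_def)
  have Z: "Z > 0"
    using assms(1,4,5) power_Suc_less_one[of "1 - p" "M - 1"] by (simp add: Z_def)
  have q0: "q 0 = 1 - Z" by (simp add: q_def active_prob_def Z_def)
  have qnn: "q L \<ge> 0" for L using assms(4,5) by (simp add: q_def active_prob_def)
  have "(\<Sum>L\<le>M. q L) = q 0 + (\<Sum>L=1..M. q L)"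
    by (simp add: sum.atMost_shift sum.atLeast1_atMost_eq lessThan_Suc_atMost)
  then have q1: "(\<Sum>L=1..M. q L) = Z"
    using sum_active_prob[of M p] q0 by (simp add: q_def)
  have rate: "real L / mean_slots K L \<ge> 1 - c * e L" if "L \<ge> 1" for L
  proof (cases "L > K")
    case True
    \<comment> \<open>The summand -1 of \<open>mean_slots_le\<close> is given away here.\<close>
    have "mean_slots K L \<le> b * real L"
      using mean_slots_le[OF assms(2) True] by (simp add: b_def)
    then have "1 / b \<le> real L / mean_slots K L"
      using b mean_slots_pos[OF assms(2), of L] by (simp add: field_simps)
    then show ?thesis using True b by (simp add: c_def e_def diff_divide_distrib)
  next
    case False
    then show ?thesis using that mean_slots_small(2)[of L K] by (simp add: e_def)
  qed
  have T: "T = (\<Sum>L=1..M. e L * q L)"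
    unfolding T_def using assms(2) by (intro sum.mono_neutral_cong_left) (auto simp: e_def)
  have cZ: "(b - 1) / (b * Z) = c / Z" by (simp add: c_def)
  \<comment> \<open>The leading 1 is written as the sum of \<open>q L / Z\<close>, so that both
    sides can be compared term by term.\<close>
  have "D / N * (1 - (b - 1) / (b * Z) * T)
      = D / N * ((\<Sum>L=1..M. q L) - c * T) / Z"
    unfolding cZ q1 using Z by (simp add: field_simps)
  also have "\<dots> = (\<Sum>L=1..M. D / N * ((1 - c * e L) * (q L / Z)))"
    unfolding T
    by (simp add: sum_subtractf sum_distrib_left sum_divide_distrib left_diff_distrib
        right_diff_distrib diff_divide_distrib mult_ac)
  also have "\<dots> \<le> (\<Sum>L=1..M. D / N * (real L / mean_slots K L * (q L / Z)))"
    using Z by (intro sum_mono mult_left_mono mult_right_mono rate D divide_nonneg_pos qnn) auto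
  also have "\<dots> = avg_net_rate N D K M p"
    unfolding avg_net_rate_def net_rate_def cond_active_prob_def
    using q0 by (simp add: q_def mult_ac)
  finally have "D / N * (1 - (b - 1) / (b * Z) * T) \<le> avg_net_rate N D K M p" .
  moreover have "D / N = 1/2 * log2_plus P
      - real_of_int (signature_length K M N) / real N * log 2 (real N * log 2 (real N))"
    using N by (simp add: D_def message_bits_def field_simps)
  moreover have "reg_inc_beta p (real K + 1) (real M - real K) = T"
    using reg_inc_beta_binomial_tail[of K M p] assms(2-5) by (simp add: T_def q_def)
  ultimately show ?thesis by (simp only: D_def b_def Z_def)
qed

end
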